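(* Suppose a lossless compression algorithm in the read/write streams model uses $m$ bits of internal memory and $p$ passes over one stream and achieves universal compression with an $O(\sigma^k r)$ redundancy term for all $k$ simultaneously, i.e., it stores every string $s$ of length $n$ over an alphabet of size $\sigma$ in $nH_k(s)+O(\sigma^k r)$ bits for every $k\ge0$. Then $m p r=\Omega(n/f(n))$ for any function $f$ that increases without bound.
   Context: Read/write streams model: an algorithm has an internal memory of $m$ bits and access to a fixed number of streams (tapes); each stream is a sequence of cells accessed sequentially by a read/write head; a pass is one sequential sweep over a stream. The input is initially on the stream. $m,p,r$ may depend on $n$. The $k$th-order empirical entropy is $H_0(s)=\frac1n\sum_a \mathrm{occ}(a,s)\log\frac{n}{\mathrm{occ}(a,s)}$ and, for $k\ge1$, $H_k(s)=\frac1n\sum_{|w|=k}|w_s|H_0(w_s)$, where $w_s$ is the concatenation of the characters immediately following occurrences of the $k$-tuple $w$ in $s$. *)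

theory Defs
  imports Complex_Main "HOL-Library.Landau_Symbols"
begin

definition words :: "'a set \<Rightarrow> nat \<Rightarrow> 'a list set" where
  "words A n = {s. length s = n \<and> set s \<subseteq> A}"

text \<open>Empirical entropy of a string over the alphabet \<open>A\<close>, in bits. A character that does not
  occur contributes \<open>0\<close>, and so does the empty string.\<close>

definition entropy0 :: "'a set \<Rightarrow> 'a list \<Rightarrow> real" where
  "entropy0 A s = 1 / real (length s) *
     (\<Sum>a\<in>A. real (count_list s a) * log 2 (real (length s) / real (count_list s a)))"

definition followers :: "'a list \<Rightarrow> 'a list \<Rightarrow> 'a list" where
  "followers s w =
     [s ! (i + length w). i \<leftarrow> [0..<length s - length w], take (length w) (drop i s) = w]"

definition entropy :: "'a set \<Rightarrow> nat \<Rightarrow> 'a list \<Rightarrow> real" where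
  "entropy A k s =
     (if k = 0 then entropy0 A s
      else 1 / real (length s) *
        (\<Sum>w\<in>words A k. real (length (followers s w)) * entropy0 A (followers s w)))"

text \<open>
  A deterministic algorithm with one read/write stream, for inputs of one fixed length; resources
  depending on the input length are modelled by a family of such machines.
  The cells hold symbols from \<open>{..<cell_syms}\<close>. The memory is a bit string that also contains any
  control state, so it determines all further behaviour together with the stream.
  At the beginning of a pass it fixes the direction of the sweep (\<open>backward\<close>), at the end
  of a pass it decides whether the algorithm stops (\<open>halted\<close>). In each cell visited, \<open>step\<close>
  updates the memory, overwrites the cell, and outputs finitely many bits (possibly none).
  An algorithm whose encoding is the final content of the stream is the special case
  that outputs, during its last pass, the bits it leaves in the cells.
\<close>

record rw_machine =
  cell_syms :: nat
  pad_left :: nat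
  pad_right :: nat
  init_mem :: "bool list"
  backward :: "bool list \<Rightarrow> bool"
  halted :: "bool list \<Rightarrow> bool"
  step :: "bool list \<Rightarrow> nat \<Rightarrow> bool list \<times> nat \<times> bool list"

text \<open>The input alphabet is \<open>{..<\<sigma>}\<close>, and the number \<open>\<sigma>\<close> itself is the blank. The input is
  surrounded by blank cells, which serve as end markers and as additional work space; as a
  computation with finitely many sweeps visits finitely many cells, a finite number suffices.\<close>

definition uses_memory :: "nat \<Rightarrow> nat \<Rightarrow> rw_machine \<Rightarrow> bool" where
  "uses_memory \<sigma> m M \<longleftrightarrow>
     \<sigma> < cell_syms M \<and> length (init_mem M) = m \<and>
     (\<forall>q a. length q = m \<longrightarrow> a < cell_syms M \<longrightarrow>
        (case step M q a of (q', b, out) \<Rightarrow> length q' = m \<and> b < cell_syms M))"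

definition initial_stream :: "nat \<Rightarrow> rw_machine \<Rightarrow> nat list \<Rightarrow> nat list" where
  "initial_stream \<sigma> M s = replicate (pad_left M) \<sigma> @ s @ replicate (pad_right M) \<sigma>"

fun sweep :: "rw_machine \<Rightarrow> bool list \<Rightarrow> nat list \<Rightarrow> bool list \<times> nat list \<times> bool list" where
  "sweep M q [] = (q, [], [])"
| "sweep M q (a # x) =
     (let (q1, b, out1) = step M q a; (q2, y, out2) = sweep M q1 x in (q2, b # y, out1 @ out2))"

definition pass :: "rw_machine \<Rightarrow> bool list \<Rightarrow> nat list \<Rightarrow> bool list \<times> nat list \<times> bool list" where
  "pass M q x =
     (if backward M q then (let (q', y, out) = sweep M q (rev x) in (q', rev y, out))
      else sweep M q x)"

text \<open>The output of a run, or \<open>None\<close> if the machine has not stopped after the given number of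
  passes.\<close>

fun run :: "rw_machine \<Rightarrow> nat \<Rightarrow> bool list \<Rightarrow> nat list \<Rightarrow> bool list option" where
  "run M 0 q x = None"
| "run M (Suc p) q x =
     (let (q', y, out) = pass M q x
      in if halted M q' then Some out else map_option (\<lambda>rest. out @ rest) (run M p q' y))"

definition encoding :: "nat \<Rightarrow> rw_machine \<Rightarrow> nat \<Rightarrow> nat list \<Rightarrow> bool list option" where
  "encoding \<sigma> M p s = run M p (init_mem M) (initial_stream \<sigma> M s)"

definition lossless_compressor :: "nat \<Rightarrow> nat \<Rightarrow> nat \<Rightarrow> nat \<Rightarrow> rw_machine \<Rightarrow> bool" where
  "lossless_compressor \<sigma> n m p M \<longleftrightarrow>
     uses_memory \<sigma> m M \<and>
     (\<forall>s\<in>words {..<\<sigma>} n. encoding \<sigma> M p s \<noteq> None) \<and>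
     (\<exists>decode. \<forall>s\<in>words {..<\<sigma>} n. decode (the (encoding \<sigma> M p s)) = s)"

definition encoded_bits :: "nat \<Rightarrow> rw_machine \<Rightarrow> nat \<Rightarrow> nat list \<Rightarrow> nat" where
  "encoded_bits \<sigma> M p s = length (the (encoding \<sigma> M p s))"

text \<open>The constant hidden in the redundancy term \<open>O(\<sigma>\<^sup>k r)\<close> depends on neither the string nor
  \<open>k\<close>: the bound holds for all \<open>k\<close> simultaneously.\<close>

definition universal_compression ::
  "nat \<Rightarrow> (nat \<Rightarrow> nat) \<Rightarrow> (nat \<Rightarrow> real) \<Rightarrow> (nat \<Rightarrow> rw_machine) \<Rightarrow> bool" where
  "universal_compression \<sigma> p r M \<longleftrightarrow>
     (\<exists>c. \<forall>\<^sub>F n in sequentially. \<forall>k. \<forall>s\<in>words {..<\<sigma>} n.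
        real (encoded_bits \<sigma> (M n) (p n) s)
          \<le> real n * entropy {..<\<sigma>} k s + c * (real \<sigma> ^ k * r n))"

end

theory Submission
  imports Defs
begin

text \<open>Compress the word of length \<open>n\<close> with period \<open>t\<close>, where \<open>t\<close> is a random word of length \<open>l\<close>
  proportional to \<open>\<sigma>\<^sup>k\<close>, and \<open>\<sigma>\<^sup>k\<close> is a large constant times \<open>m p\<close>. What the machine does while its
  head is inside one period (the memory contents on entering and leaving it, and the bits output
  inside) determines that period: otherwise two periods could be exchanged without changing the
  encoding. As the memory contents amount to only \<open>O(m p)\<close> bits, most \<open>t\<close> force \<open>\<Omega>(l)\<close> output
  bits per period, hence \<open>\<Omega>(n)\<close> in total. On the other hand, few of the \<open>l\<close> cyclic factors of
  length \<open>k\<close> of a random \<open>t\<close> coincide with another one, so that almost every character of the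
  periodic word is determined by its \<open>k\<close> predecessors and \<open>n H\<^sub>k\<close> is a small fraction of \<open>n\<close>.
  Therefore \<open>\<sigma>\<^sup>k r = O(m p r)\<close> must make up for the rest: even \<open>m p r = \<Omega>(n)\<close> holds.
  If \<open>n < l\<close>, this follows from \<open>r = \<Omega>(1)\<close>, which is necessary to encode two constant words.\<close>

section \<open>Crossings of a window of the stream\<close>

text \<open>A crossing of the window \<open>b\<close> in the stream \<open>a @ b @ c\<close> records the direction, the memory on
  entering and on leaving the window, and the bits output inside it.\<close>

type_synonym crossing = "bool \<times> bool list \<times> bool list \<times> bool list"

definition window_pass ::
  "rw_machine \<Rightarrow> bool list \<Rightarrow> nat list \<Rightarrow> nat list \<Rightarrow> nat list \<Rightarrow>
     crossing \<times> bool list \<times> nat list \<times> nat list \<times> nat list" where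
  "window_pass M q a b c =
     (if backward M q then
        (let (q1, c', _) = sweep M q (rev c); (q2, b', out) = sweep M q1 (rev b);
             (q3, a', _) = sweep M q2 (rev a)
         in ((True, q1, q2, out), q3, rev a', rev b', rev c'))
      else
        (let (q1, a', _) = sweep M q a; (q2, b', out) = sweep M q1 b;
             (q3, c', _) = sweep M q2 c
         in ((False, q1, q2, out), q3, a', b', c')))"

fun crossings ::
  "rw_machine \<Rightarrow> nat \<Rightarrow> bool list \<Rightarrow> nat list \<Rightarrow> nat list \<Rightarrow> nat list \<Rightarrow> crossing list" where
  "crossings M 0 q a b c = []"
| "crossings M (Suc p) q a b c =
     (let (e, q', a', b', c') = window_pass M q a b c
      in e # (if halted M q' then [] else crossings M p q' a' b' c'))"

definition traffic :: "crossing list \<Rightarrow> nat" where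
  "traffic es = (\<Sum>(d, q1, q2, out)\<leftarrow>es. length out)"

lemma traffic_simps [simp]:
  "traffic [] = 0"
  "traffic ((d, q1, q2, out) # es) = length out + traffic es"
  by (simp_all add: traffic_def)

lemma sweep_append:
  "sweep M q (x @ y) =
     (let (q1, x', out1) = sweep M q x; (q2, y', out2) = sweep M q1 y
      in (q2, x' @ y', out1 @ out2))"
  by (induction x arbitrary: q) (auto simp: Let_def split: prod.splits)

text \<open>Cut and paste: the cells outside the window notice its content only through the memory
  that leaves it. With equal crossings, the mixed run acts like the first run outside the window and
  like the second inside it. The second run may have other memory and surroundings, as those of the
  two runs evolve separately.\<close>

lemma run_exchange_window:
  assumes "crossings M p q a b c = crossings M p q2 a2 b2 c2"
  shows "run M p q (a @ b2 @ c) = run M p q (a @ b @ c)"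
  using assms
proof (induction p arbitrary: q q2 a b c a2 b2 c2)
  case 0
  then show ?case by simp
next
  case (Suc p)
  obtain d1 i1 o1 out1 q' a' b' c' where w:
    "window_pass M q a b c = ((d1, i1, o1, out1), q', a', b', c')"
    by (metis prod.exhaust)
  obtain d2 i2 o2 out2 q2' a2' b2' c2' where w2:
    "window_pass M q2 a2 b2 c2 = ((d2, i2, o2, out2), q2', a2', b2', c2')"
    by (metis prod.exhaust)
  have e: "d1 = d2" "i1 = i2" "o1 = o2" "out1 = out2"
    and tl: "(if halted M q' then [] else crossings M p q' a' b' c') =
      (if halted M q2' then [] else crossings M p q2' a2' b2' c2')"
    using Suc.prems by (simp_all add: w w2)
  obtain z where z: "pass M q (a @ b @ c) = (q', a' @ b' @ c', z)"
    and zz: "pass M q (a @ b2 @ c) = (q', a' @ b2' @ c', z)"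
    using w w2 e
    by (auto simp: window_pass_def pass_def sweep_append Let_def
        split: prod.splits if_splits)
  show ?case
  proof (cases "halted M q'")
    case True
    then show ?thesis by (simp add: z zz)
  next
    case False
    have "run M p q' (a' @ b2' @ c') = run M p q' (a' @ b' @ c')"
    \<comment> \<open>Crossings do not show the memory at the end of a pass, so the second run may
      halt here while the first goes on. Equality of the lists then leaves no passes to the first
      run.\<close>
    proof (cases "halted M q2'")
      case True
      then have "crossings M p q' a' b' c' = []" using tl False by simp
      then have "p = 0" by (cases p) (auto simp: Let_def split: prod.splits)
      then show ?thesis by simp
    next
      case f2: False
      then show ?thesis using tl False by (intro Suc.IH) simp
    qed
    then show ?thesis by (simp add: z zz False)
  qed
qed

text \<open>All three terms watch different cells of one and the same run, so they halt together. A
  backward sweep visits \<open>b'\<close> before \<open>b\<close>, but only lengths are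
  added.\<close>

lemma traffic_append_windows:
  "traffic (crossings M p q a (b @ b') c) =
     traffic (crossings M p q a b (b' @ c)) + traffic (crossings M p q (a @ b) b' c)"
proof (induction p arbitrary: q a b b' c)
  case 0
  then show ?case by simp
next
  case (Suc p)
  show ?case
    by (cases "backward M q")
      (auto simp: window_pass_def sweep_append Let_def Suc.IH split: prod.splits)
qed

lemma traffic_empty_window: "traffic (crossings M p q a [] c) = 0"
  \<comment> \<open>Additivity gives \<open>t = t + t\<close> for the traffic \<open>t\<close> of an
    empty window.\<close>
  using traffic_append_windows[of M p q a "[]" "[]" c] by simp

lemma length_run:
  "run M p q x = Some out \<Longrightarrow> length out = traffic (crossings M p q [] x [])"
proof (induction p arbitrary: q x out)
  case 0
  then show ?case by simp
next
  case (Suc p)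
  then show ?case
    by (fastforce simp: window_pass_def pass_def Let_def split: prod.splits if_splits)
qed

text \<open>Windows between consecutive cut points are adjacent, so their traffic telescopes to that
  of one large window; the cells to its left and right can only add output.\<close>

lemma sum_traffic_le:
  fixes g :: "nat \<Rightarrow> nat"
  assumes "mono g"
  shows "(\<Sum>j<N. traffic (crossings M p q (take (g j) x)
            (take (g (Suc j) - g j) (drop (g j) x)) (drop (g (Suc j)) x)))
         \<le> traffic (crossings M p q [] x [])"
proof -
  let ?W = "\<lambda>i j. traffic (crossings M p q (take i x) (take (j - i) (drop i x)) (drop j x))"
  have split: "?W i l = ?W i j + ?W j l" if "i \<le> j" "j \<le> l" for i j l
  proof -
    have "l - i = (j - i) + (l - j)" "j - i + i = j" using that by simp_all
    then have 1: "take (l - i) (drop i x) = take (j - i) (drop i x) @ take (l - j) (drop j x)"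
      by (simp only: take_add drop_drop)
    have "drop l x = drop (l - j) (drop j x)" using that by simp
    then have 2: "take (l - j) (drop j x) @ drop l x = drop j x"
      by (simp only: append_take_drop_id)
    have 3: "take i x @ take (j - i) (drop i x) = take j x"
      using take_add[of i "j - i" x] that by simp
    show ?thesis
      by (simp only: 1 traffic_append_windows 2 3)
  qed
  have "(\<Sum>j<N. ?W (g j) (g (Suc j))) = ?W (g 0) (g N)"
  proof (induction N)
    case 0
    then show ?case by (simp add: traffic_empty_window)
  next
    case (Suc N)
    then show ?case using split[of "g 0" "g N" "g (Suc N)"] assms
      by (simp add: monoD)
  qed
  \<comment> \<open>Cut points may lie beyond the end of the stream, hence the maximum as final
    endpoint.\<close>
  also have "\<dots> \<le> ?W 0 (g N) + ?W (g N) (max (g N) (length x))"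
    using split[of 0 "g 0" "g N"] assms by (simp add: monoD)
  also have "\<dots> = ?W 0 (max (g N) (length x))"
    using split[of 0 "g N" "max (g N) (length x)"] by simp
  also have "\<dots> = traffic (crossings M p q [] x [])"
    by simp
  finally show ?thesis .
qed

section \<open>Counting crossing sequences\<close>

lemma sweep_uses_memory:
  assumes "uses_memory \<sigma> m M" "length q = m" "set x \<subseteq> {..<cell_syms M}"
    "sweep M q x = (q', y, out)"
  shows "length q' = m \<and> set y \<subseteq> {..<cell_syms M}"
  using assms(2-)
proof (induction x arbitrary: q y out)
  case Nil
  then show ?case by simp
next
  case (Cons a x)
  obtain q1 b o1 where s: "step M q a = (q1, b, o1)" by (metis prod.exhaust)
  have "length q1 = m" "b < cell_syms M"
    using assms(1) Cons.prems s unfolding uses_memory_def by force+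
  moreover obtain q2 y2 o2 where s2: "sweep M q1 x = (q2, y2, o2)" by (metis prod.exhaust)
  ultimately show ?case using Cons.IH[of q1 y2 o2] Cons.prems s by auto
qed

lemma window_pass_uses_memory:
  assumes "uses_memory \<sigma> m M" "length q = m" "set (a @ b @ c) \<subseteq> {..<cell_syms M}"
    "window_pass M q a b c = ((d, q1, q2, out), q', a', b', c')"
  shows "length q1 = m" "length q2 = m" "length q' = m"
    "set (a' @ b' @ c') \<subseteq> {..<cell_syms M}"
proof -
  note sw = sweep_uses_memory[OF assms(1)]
  have "length q1 = m \<and> length q2 = m \<and> length q' = m \<and> set (a' @ b' @ c') \<subseteq> {..<cell_syms M}"
  proof (cases "backward M q")
    case True
    then obtain oc ob oa c'' b'' a'' where
      "sweep M q (rev c) = (q1, c'', oc)" "sweep M q1 (rev b) = (q2, b'', ob)"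
      "sweep M q2 (rev a) = (q', a'', oa)" "a' = rev a''" "b' = rev b''" "c' = rev c''"
      using assms(4) by (auto simp: window_pass_def Let_def split: prod.splits)
    moreover from this have "length q1 = m \<and> set c'' \<subseteq> {..<cell_syms M}"
      using assms(2,3) by (intro sw[of q "rev c"]) auto
    moreover from calculation have "length q2 = m \<and> set b'' \<subseteq> {..<cell_syms M}"
      using assms(3) by (intro sw[of q1 "rev b"]) auto
    moreover from calculation have "length q' = m \<and> set a'' \<subseteq> {..<cell_syms M}"
      using assms(3) by (intro sw[of q2 "rev a"]) auto
    ultimately show ?thesis by simp
  next
    case False
    then obtain oc ob oa where
      "sweep M q a = (q1, a', oa)" "sweep M q1 b = (q2, b', ob)" "sweep M q2 c = (q', c', oc)"
      using assms(4) by (auto simp: window_pass_def Let_def split: prod.splits)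
    moreover from this have "length q1 = m \<and> set a' \<subseteq> {..<cell_syms M}"
      using assms(2,3) by (intro sw[of q a]) auto
    moreover from calculation have "length q2 = m \<and> set b' \<subseteq> {..<cell_syms M}"
      using assms(3) by (intro sw[of q1 b]) auto
    moreover from calculation have "length q' = m \<and> set c' \<subseteq> {..<cell_syms M}"
      using assms(3) by (intro sw[of q2 c]) auto
    ultimately show ?thesis by simp
  qed
  then show "length q1 = m" "length q2 = m" "length q' = m"
    "set (a' @ b' @ c') \<subseteq> {..<cell_syms M}" by blast+
qed

text \<open>Outputs are left unbounded here; their total length is controlled separately by
  \<open>traffic\<close>.\<close>

definition bounded_crossings :: "nat \<Rightarrow> nat \<Rightarrow> crossing list set" where
  "bounded_crossings m p =
     {es. length es \<le> p \<and> (\<forall>(d, q1, q2, out)\<in>set es. length q1 = m \<and> length q2 = m)}"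

lemma crossings_bounded:
  assumes "uses_memory \<sigma> m M" "length q = m" "set (a @ b @ c) \<subseteq> {..<cell_syms M}"
  shows "crossings M p q a b c \<in> bounded_crossings m p"
  using assms(2-)
proof (induction p arbitrary: q a b c)
  case 0
  then show ?case by (simp add: bounded_crossings_def)
next
  case (Suc p)
  obtain d i e out q' a' b' c' where w:
    "window_pass M q a b c = ((d, i, e, out), q', a', b', c')"
    by (metis prod.exhaust)
  note u = window_pass_uses_memory[OF assms(1) Suc.prems w]
  show ?case using Suc.IH[OF u(3,4)] u(1,2) by (auto simp: w bounded_crossings_def)
qed

text \<open>A prefix code: a flag before each bit announces that the string continues. Outputs have
  no fixed length, so they need delimiters; the price is a factor 2.\<close>

fun self_delimiting :: "bool list \<Rightarrow> bool list" where
  "self_delimiting [] = [False]"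
| "self_delimiting (b # bs) = True # b # self_delimiting bs"

lemma length_self_delimiting [simp]: "length (self_delimiting bs) = 2 * length bs + 1"
  by (induction bs) auto

lemma self_delimiting_prefix_free:
  "self_delimiting x @ r = self_delimiting x' @ r' \<Longrightarrow> x = x' \<and> r = r'"
proof (induction x arbitrary: x')
  case Nil
  then show ?case by (cases x') auto
next
  case (Cons a x)
  then show ?case by (cases x') auto
qed

fun crossing_code :: "crossing list \<Rightarrow> bool list" where
  "crossing_code [] = []"
| "crossing_code ((d, q1, q2, out) # es) =
     d # q1 @ q2 @ self_delimiting out @ crossing_code es"

text \<open>Decoding from left to right: both memories have the known length \<open>m\<close>, the
  output is prefix-coded, and the list ends where the string ends because no record has an empty
  code.\<close>

lemma inj_on_crossing_code: "inj_on crossing_code (bounded_crossings m p)"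
proof (rule inj_onI)
  fix es es' assume "es \<in> bounded_crossings m p" "es' \<in> bounded_crossings m p"
    "crossing_code es = crossing_code es'"
  then show "es = es'"
  proof (induction es arbitrary: es' p rule: crossing_code.induct)
    case 1
    then show ?case by (cases es') auto
  next
    case (2 d q1 q2 out es)
    obtain d' q1' q2' out' es'' where e: "es' = (d', q1', q2', out') # es''"
      using 2(4) by (cases es') auto
    have l: "length q1 = length q1'" "length q2 = length q2'"
      using 2(2,3) by (auto simp: e bounded_crossings_def)
    have r: "d = d'" "q1 = q1'" "q2 = q2'"
      "self_delimiting out @ crossing_code es = self_delimiting out' @ crossing_code es''"
      using 2(4) l by (auto simp: e)
    have "es = es''"
      using 2 self_delimiting_prefix_free[OF r(4)]
      by (intro 2(1)[of p]) (auto simp: e bounded_crossings_def)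
    then show ?case using r self_delimiting_prefix_free[OF r(4)] by (simp add: e)
  qed
qed

text \<open>A record costs one bit for the direction, \<open>2 * m\<close> for the two memories and
  \<open>2 * length out + 1\<close> for the output.\<close>

lemma length_crossing_code:
  "es \<in> bounded_crossings m p \<Longrightarrow> length (crossing_code es) \<le> p * (2 * m + 2) + 2 * traffic es"
proof (induction es arbitrary: p rule: crossing_code.induct)
  case 1
  then show ?case by simp
next
  case (2 d q1 q2 out es)
  then obtain p' where p: "p = Suc p'" by (cases p) (auto simp: bounded_crossings_def)
  have "length (crossing_code es) \<le> p' * (2 * m + 2) + 2 * traffic es"
    using 2(2) by (intro 2(1)) (auto simp: p bounded_crossings_def)
  then show ?case using 2(2) by (auto simp: p bounded_crossings_def)
qed

lemma card_bit_strings_le: "card {bs :: bool list. length bs \<le> K} \<le> 2 ^ (K + 1)"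
proof -
  have "card {bs :: bool list. length bs \<le> K} = (\<Sum>i\<le>K. 2 ^ i)"
    using card_lists_length_le[of "UNIV :: bool set" K] by simp
  also have "\<dots> \<le> 2 ^ (K + 1)"
    using sum_power2[of "K + 1"] by (simp add: atLeast0LessThan lessThan_Suc_atMost)
  finally show ?thesis .
qed

text \<open>Pigeonhole: crossings with little output have short codes, so they can tell only few
  words apart.\<close>

lemma card_crossings_le:
  fixes F :: "'a \<Rightarrow> crossing list"
  assumes "inj_on F T" "F ` T \<subseteq> bounded_crossings m p" "\<And>t. t \<in> T \<Longrightarrow> traffic (F t) \<le> L"
  shows "card T \<le> 2 ^ (p * (2 * m + 2) + 2 * L + 1)"
proof -
  let ?K = "p * (2 * m + 2) + 2 * L"
  have "inj_on (crossing_code \<circ> F) T"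
    using assms(1,2) by (meson comp_inj_on inj_on_crossing_code inj_on_subset)
  moreover have "(crossing_code \<circ> F) ` T \<subseteq> {bs. length bs \<le> ?K}"
  proof
    fix bs assume "bs \<in> (crossing_code \<circ> F) ` T"
    then obtain t where t: "t \<in> T" "bs = crossing_code (F t)" by auto
    have "length bs \<le> p * (2 * m + 2) + 2 * traffic (F t)"
      using t assms(2) length_crossing_code by blast
    then show "bs \<in> {bs. length bs \<le> ?K}" using assms(3)[OF t(1)] by simp
  qed
  moreover have "finite {bs :: bool list. length bs \<le> ?K}"
    using finite_lists_length_le[of "UNIV :: bool set"] by simp
  ultimately have "card T \<le> card {bs :: bool list. length bs \<le> ?K}"
    by (metis card_image card_mono)
  then show ?thesis using card_bit_strings_le[of ?K] by linarith
qed

section \<open>Entropy of periodic words\<close>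

lemma finite_words: "finite A \<Longrightarrow> finite (words A n)"
  using finite_lists_length_eq[of A n] by (simp add: words_def conj_commute)

lemma card_words: "finite A \<Longrightarrow> card (words A n) = card A ^ n"
  using card_lists_length_eq[of A n] by (simp add: words_def conj_commute)

lemma followers_conv:
  "followers s w = map (\<lambda>i. s ! (i + length w))
     (filter (\<lambda>i. take (length w) (drop i s) = w) [0..<length s - length w])"
proof -
  have "concat (map (\<lambda>i. if P i then [g i] else []) xs) = map g (filter P xs)"
    for P :: "nat \<Rightarrow> bool" and g :: "nat \<Rightarrow> 'a" and xs
    by (induction xs) auto
  then show ?thesis by (simp add: followers_def)
qed

lemma entropy0_constant:
  assumes "set s \<subseteq> {x}"
  shows "entropy0 A s = 0"
proof -
  have "count_list s a = (if a = x then length s else 0)" for a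
    using assms by (induction s) auto
  then have "real (count_list s a) * log 2 (real (length s) / real (count_list s a)) = 0" for a
    by (cases "length s = 0") auto
  then show ?thesis unfolding entropy0_def by (simp only: sum.neutral_const mult_zero_right)
qed

text \<open>The uniform distribution maximises entropy. The proof is Gibbs' inequality, from
  \<open>ln x \<le> x - 1\<close> at \<open>x = n / (c * N)\<close>.\<close>

lemma length_entropy0_le:
  assumes "finite A" "set s \<subseteq> A"
  shows "real (length s) * entropy0 A s \<le> real (length s) * log 2 (real (card A))"
proof (cases "s = []")
  case True
  then show ?thesis by simp
next
  case False
  define n where "n = real (length s)"
  define N where "N = real (card A)"
  have n: "n > 0" using False by (simp add: n_def)
  have N: "N > 0" using False assms by (auto simp: N_def card_gt_0_iff)
  have tot: "(\<Sum>a\<in>A. real (count_list s a)) = n"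
    using sum_count_set[OF assms(2,1)] by (simp add: n_def flip: of_nat_sum)
  \<comment> \<open>The corrections \<open>n / N - count_list s a\<close> cancel when summed over
    \<open>A\<close>.\<close>
  have le: "real (count_list s a) * ln (n / real (count_list s a))
      \<le> real (count_list s a) * ln N + (n / N - real (count_list s a))" for a
  proof (cases "count_list s a = 0")
    case True
    then show ?thesis using n N by simp
  next
    case f: False
    define c where "c = real (count_list s a)"
    have c: "c > 0" using f by (simp add: c_def)
    have "ln (n / c) = ln N + ln (n / (c * N))"
      using c n N by (simp add: ln_div ln_mult)
    also have "\<dots> \<le> ln N + (n / (c * N) - 1)"
      using c n N ln_le_minus_one[of "n / (c * N)"] by simp
    finally have "c * ln (n / c) \<le> c * (ln N + (n / (c * N) - 1))"
      using c by (intro mult_left_mono) auto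
    also have "\<dots> = c * ln N + (n / N - c)"
      using c by (simp add: algebra_simps)
    finally show ?thesis by (simp add: c_def)
  qed
  have "(\<Sum>a\<in>A. real (count_list s a) * ln (n / real (count_list s a)))
      \<le> (\<Sum>a\<in>A. real (count_list s a) * ln N + (n / N - real (count_list s a)))"
    by (intro sum_mono le)
  also have "\<dots> = n * ln N"
    using N tot by (simp add: sum.distrib sum_subtractf N_def flip: sum_distrib_right)
  finally have "(\<Sum>a\<in>A. real (count_list s a) * ln (n / real (count_list s a))) / ln 2
      \<le> n * ln N / ln 2"
    by (intro divide_right_mono) auto
  moreover have "real (length s) * entropy0 A s
      = (\<Sum>a\<in>A. real (count_list s a) * ln (n / real (count_list s a))) / ln 2"
    unfolding entropy0_def log_def n_def[symmetric] using n
    by (simp only: sum_divide_distrib) (simp add: mult.assoc[symmetric])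
  ultimately show ?thesis by (simp add: log_def n_def N_def)
qed

text \<open>A context with a single follower contributes no entropy. Every occurrence of any other
  context has a companion with a different follower, so it is counted on the right, and it costs at
  most \<open>log 2 (card A)\<close> bits.\<close>

lemma length_entropy_le:
  assumes "finite A" "set s \<subseteq> A" "k \<ge> 1"
  shows "real (length s) * entropy A k s \<le> log 2 (real (card A)) *
     real (card {i. i + k < length s \<and> (\<exists>i'. i' + k < length s \<and>
        take k (drop i s) = take k (drop i' s) \<and> s ! (i + k) \<noteq> s ! (i' + k))})"
    (is "_ \<le> ?lg * real (card ?D)")
proof (cases "s = []")
  case True
  then show ?thesis by simp
next
  case False
  then have N: "card A \<ge> 1" using assms by (auto simp: Suc_le_eq card_gt_0_iff)
  have lg: "?lg \<ge> 0" using N by simp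
  have fD: "finite ?D" by (rule finite_subset[of _ "{..<length s}"]) auto
  have each: "real (length (followers s w)) * entropy0 A (followers s w)
      \<le> ?lg * real (card {i\<in>?D. take k (drop i s) = w})" if "w \<in> words A k" for w
  proof -
    have w: "length w = k" using that by (simp add: words_def)
    define I where "I = {i. i + k < length s \<and> take k (drop i s) = w}"
    have len: "length (followers s w) = card I"
      unfolding followers_conv w length_map I_def
      by (subst distinct_card[symmetric]) (auto intro!: arg_cong[where f = card])
    have set: "set (followers s w) = (\<lambda>i. s ! (i + k)) ` I"
      unfolding followers_conv w I_def by auto
    show ?thesis
    proof (cases "\<exists>x. set (followers s w) \<subseteq> {x}")
      case True
      then show ?thesis using lg entropy0_constant by fastforce
    next
      case False
      have "I \<subseteq> {i\<in>?D. take k (drop i s) = w}"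
      proof
        fix i assume i: "i \<in> I"
        obtain i' where "i' \<in> I" "s ! (i' + k) \<noteq> s ! (i + k)"
          using False unfolding set by blast
        then show "i \<in> {i\<in>?D. take k (drop i s) = w}" using i unfolding I_def by force
      qed
      then have "card I \<le> card {i\<in>?D. take k (drop i s) = w}"
        by (rule card_mono[rotated]) (rule finite_subset[OF _ fD], blast)
      moreover have "set (followers s w) \<subseteq> A"
        unfolding set I_def using assms(2) by auto
      then have "real (length (followers s w)) * entropy0 A (followers s w)
          \<le> real (length (followers s w)) * ?lg"
        by (intro length_entropy0_le assms)
      moreover from calculation(1) have "real (card I) * ?lg
          \<le> real (card {i\<in>?D. take k (drop i s) = w}) * ?lg"
        using lg by (intro mult_right_mono) simp_all
      ultimately show ?thesis unfolding len by (simp only: mult.commute[of ?lg])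
    qed
  qed
  have "real (length s) * entropy A k s
      = (\<Sum>w\<in>words A k. real (length (followers s w)) * entropy0 A (followers s w))"
    using assms(3) False by (simp add: entropy_def)
  also have "\<dots> \<le> (\<Sum>w\<in>words A k. ?lg * real (card {i\<in>?D. take k (drop i s) = w}))"
    by (intro sum_mono each)
  also have "\<dots> = ?lg * real (\<Sum>w\<in>words A k. card {i\<in>?D. take k (drop i s) = w})"
    by (simp add: sum_distrib_left)
  also have "(\<Sum>w\<in>words A k. card {i\<in>?D. take k (drop i s) = w})
      = card (\<Union>w\<in>words A k. {i\<in>?D. take k (drop i s) = w})"
    by (intro card_UN_disjoint[symmetric] finite_words assms ballI impI finite_subset[OF _ fD])
      auto
  also have "\<dots> \<le> card ?D"
    using fD by (intro card_mono) auto
  finally show ?thesis using lg by (simp add: mult_left_mono)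
qed

section \<open>Repeated factors of periodic words\<close>

definition periodic_word :: "nat \<Rightarrow> 'a list \<Rightarrow> 'a list" where
  "periodic_word n t = map (\<lambda>i. t ! (i mod length t)) [0..<n]"

text \<open>Indices wrap around because a factor that starts near the end of one period continues in
  the next.\<close>

definition cyclic_factor :: "nat \<Rightarrow> 'a list \<Rightarrow> nat \<Rightarrow> 'a list" where
  "cyclic_factor k t u = map (\<lambda>j. t ! ((u + j) mod length t)) [0..<k]"

definition repeated_factors :: "nat \<Rightarrow> 'a list \<Rightarrow> nat set" where
  "repeated_factors k t = {u. u < length t \<and>
     (\<exists>v<length t. v \<noteq> u \<and> cyclic_factor k t u = cyclic_factor k t v)}"

lemma length_periodic_word [simp]: "length (periodic_word n t) = n"
  by (simp add: periodic_word_def)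

lemma nth_periodic_word [simp]: "i < n \<Longrightarrow> periodic_word n t ! i = t ! (i mod length t)"
  by (simp add: periodic_word_def)

lemma periodic_word_in_words:
  assumes "t \<in> words A l" "l > 0"
  shows "periodic_word n t \<in> words A n"
  using assms by (fastforce simp: words_def periodic_word_def)

lemma period_of_periodic_word:
  assumes "length t = l" "Suc j * l \<le> n"
  shows "take l (drop (j * l) (periodic_word n t)) = t"
proof (rule nth_equalityI)
  show "length (take l (drop (j * l) (periodic_word n t))) = length t"
    using assms by simp
next
  fix i assume "i < length (take l (drop (j * l) (periodic_word n t)))"
  then have "i < l" "j * l + i < n" using assms by auto
  then show "take l (drop (j * l) (periodic_word n t)) ! i = t ! i"
    using assms by simp
qed

lemma factor_periodic_word:
  assumes "i + k \<le> n"
  shows "take k (drop i (periodic_word n t)) = cyclic_factor k t (i mod length t)"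
  using assms by (intro nth_equalityI) (auto simp: cyclic_factor_def mod_add_left_eq)

text \<open>Positions congruent modulo \<open>l\<close> have equal followers. So a position whose
  context has two followers shares its factor with another residue, and its own residue lies in
  \<open>repeated_factors k t\<close>. Each residue occurs at most once per period, counting an
  incomplete last one.\<close>

lemma length_entropy_periodic_word_le:
  assumes "finite A" "t \<in> words A l" "l > 0" "k \<ge> 1"
  shows "real n * entropy A k (periodic_word n t) \<le>
     log 2 (real (card A)) * (real (n div l + 1) * real (card (repeated_factors k t)))"
proof -
  let ?s = "periodic_word n t"
  let ?D = "{i. i + k < length ?s \<and> (\<exists>i'. i' + k < length ?s \<and>
        take k (drop i ?s) = take k (drop i' ?s) \<and> ?s ! (i + k) \<noteq> ?s ! (i' + k))}"
  have l: "length t = l" using assms by (simp add: words_def)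
  have tA: "set t \<subseteq> A" using assms by (simp add: words_def)
  have "A \<noteq> {}" using assms l tA by auto
  then have lg: "log 2 (real (card A)) \<ge> 0"
    using assms(1) by (simp add: Suc_le_eq card_gt_0_iff)
  have sub: "(\<lambda>i. (i div l, i mod l)) ` ?D \<subseteq> {..n div l} \<times> repeated_factors k t"
  proof clarify
    fix i i' assume a: "i + k < length ?s" "i' + k < length ?s"
      "take k (drop i ?s) = take k (drop i' ?s)" "?s ! (i + k) \<noteq> ?s ! (i' + k)"
    have "i mod l \<noteq> i' mod l"
    proof
      assume "i mod l = i' mod l"
      then have "(i + k) mod l = (i' + k) mod l" by (metis mod_add_left_eq)
      then show False using a l by simp
    qed
    moreover have "cyclic_factor k t (i mod l) = cyclic_factor k t (i' mod l)"
      using a factor_periodic_word[of i k n t] factor_periodic_word[of i' k n t] l by simp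
    ultimately have "i mod l \<in> repeated_factors k t"
      using assms(3) l by (auto simp: repeated_factors_def intro!: exI[of _ "i' mod l"])
    moreover have "i div l \<le> n div l" using a by (intro div_le_mono) simp
    ultimately show "i div l \<in> {..n div l} \<and> i mod l \<in> repeated_factors k t" by simp
  qed
  have fin: "finite (repeated_factors k t)" by (simp add: repeated_factors_def)
  have "inj_on (\<lambda>i. (i div l, i mod l)) ?D"
    by (rule inj_onI) (metis div_mult_mod_eq prod.inject)
  then have "card ?D \<le> card ({..n div l} \<times> repeated_factors k t)"
    using sub fin by (metis (no_types, lifting) card_inj_on_le finite_SigmaI finite_atMost)
  then have "real (card ?D) \<le> real (n div l + 1) * real (card (repeated_factors k t))"
    unfolding of_nat_mult[symmetric] of_nat_le_iff by (simp add: card_cartesian_product)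
  moreover have "real n * entropy A k ?s \<le> log 2 (real (card A)) * real (card ?D)"
    using length_entropy_le[OF assms(1) _ assms(4), of ?s]
      periodic_word_in_words[OF assms(2,3), of n] by (simp add: words_def)
  ultimately show ?thesis using lg by (meson mult_left_mono order_trans)
qed

text \<open>A character covered by the later occurrence equals one further left, so the word is determined
  by the characters outside the later occurrence.\<close>

lemma card_equal_factors_le:
  assumes "finite A" "u \<noteq> v" "u + k \<le> l" "v + k \<le> l"
  shows "card {t \<in> words A l. take k (drop u t) = take k (drop v t)} \<le> card A ^ (l - k)"
proof -
  have main: "card {t \<in> words A l. take k (drop u t) = take k (drop v t)} \<le> card A ^ (l - k)"
    if uv: "u < v" "v + k \<le> l" for u v
  proof -
    let ?T = "{t \<in> words A l. take k (drop u t) = take k (drop v t)}"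
    let ?g = "\<lambda>t. take v t @ drop (v + k) t"
    have "inj_on ?g ?T"
    proof (rule inj_onI)
      fix t t' assume t: "t \<in> ?T" and t': "t' \<in> ?T" and g: "?g t = ?g t'"
      have len: "length t = l" "length t' = l" using t t' by (auto simp: words_def)
      have pre: "take v t = take v t'" and suf: "drop (v + k) t = drop (v + k) t'"
        using g len by (auto simp: append_eq_append_conv)
      have shift: "x ! (v + j) = x ! (u + j)" if "x \<in> ?T" "j < k" for x j
      proof -
        have "take k (drop u x) ! j = take k (drop v x) ! j" using that by simp
        then show ?thesis using that uv by (simp add: words_def)
      qed
      have "i < l \<Longrightarrow> t ! i = t' ! i" for i
      proof (induction i rule: less_induct)
        case (less i)
        consider "i < v" | "v + k \<le> i" | "v \<le> i" "i < v + k" by linarith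
        then show ?case
        proof cases
          case 1
          then show ?thesis using arg_cong[OF pre, of "\<lambda>x. x ! i"] by simp
        next
          case 2
          then show ?thesis
            using arg_cong[OF suf, of "\<lambda>x. x ! (i - (v + k))"] less.prems len by simp
        next
          case 3
          define j where "j = i - v"
          have j: "i = v + j" "j < k" using 3 by (auto simp: j_def)
          \<comment> \<open>Overlapping occurrences do no harm: \<open>u + j\<close> is smaller than
            \<open>i = v + j\<close>, so the induction hypothesis applies to it.\<close>
          show ?thesis
            using less.IH[of "u + j"] less.prems shift[OF t j(2)] shift[OF t' j(2)] uv j by simp
        qed
      qed
      then show "t = t'" using len by (intro nth_equalityI) auto
    qed
    moreover have "?g ` ?T \<subseteq> words A (l - k)"
      using uv by (fastforce simp: words_def dest: in_set_takeD in_set_dropD)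
    ultimately have "card ?T \<le> card (words A (l - k))"
      using finite_words[OF assms(1)] by (meson card_inj_on_le)
    then show ?thesis by (simp add: card_words assms(1))
  qed
  show ?thesis
  proof (cases "u < v")
    case True
    then show ?thesis using main assms by blast
  next
    case False
    then have "v < u" using assms(2) by simp
    then show ?thesis using main[of v u] assms(3) by (simp add: eq_commute)
  qed
qed

text \<open>Factors that wrap around the end of \<open>t\<close> are counted trivially: there are fewer than \<open>k\<close> of them,
  and each agrees with at most one non-wrapping factor that is unique among its kind.\<close>

lemma sum_card_repeated_factors_le:
  assumes "finite A" "k \<le> l"
  shows "(\<Sum>t\<in>words A l. card (repeated_factors k t))
     \<le> l * l * card A ^ (l - k) + 2 * k * card A ^ l"
proof -
  define P where "P = {(u, v). u + k \<le> l \<and> v + k \<le> l \<and> u < l \<and> v < l \<and> u \<noteq> v}"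
  have Psub: "P \<subseteq> {..<l} \<times> {..<l}" by (auto simp: P_def)
  then have fP: "finite P" by (rule finite_subset) simp
  have cP: "card P \<le> l * l"
    using card_mono[OF _ Psub] by (simp add: card_cartesian_product)
  define Q where "Q t = {(u, v)\<in>P. take k (drop u t) = take k (drop v t)}" for t :: "'a list"
  have fQ: "finite (Q t)" for t
    by (rule finite_subset[OF _ fP]) (auto simp: Q_def)
  have each: "card (repeated_factors k t) \<le> card (Q t) + 2 * k" if t: "t \<in> words A l" for t
  proof -
    \<comment> \<open>\<open>W\<close> holds the wrapping positions, \<open>N\<close> the
      non-wrapping ones repeated at a non-wrapping position, and \<open>U\<close> the non-wrapping
      ones that agree only with wrapping ones. Factors at different positions of \<open>U\<close>
      differ, so \<open>U\<close> is no larger than \<open>W\<close>.\<close>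
    define W where "W = {u. u < l \<and> l < u + k}"
    define N where "N = fst ` Q t"
    define U where "U = {u. u < l \<and> u \<notin> W \<and> u \<notin> N \<and>
      cyclic_factor k t u \<in> cyclic_factor k t ` W}"
    have len: "length t = l" using t by (simp add: words_def)
    have W: "card W \<le> k" "finite W"
    proof -
      have "W \<subseteq> {l - k..<l}" by (auto simp: W_def)
      then show "card W \<le> k" "finite W"
        using card_mono[of "{l - k..<l}" W] assms(2) finite_subset by auto
    qed
    have cf: "cyclic_factor k t u = take k (drop u t)" if "u + k \<le> l" for u
      using that len by (intro nth_equalityI) (auto simp: cyclic_factor_def)
    have inN: "u \<in> N" if "u < l" "v < l" "u \<notin> W" "v \<notin> W" "u \<noteq> v"
      "cyclic_factor k t u = cyclic_factor k t v" for u v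
    proof -
      have "(u, v) \<in> Q t"
        using that cf[of u] cf[of v] by (auto simp: Q_def P_def W_def)
      then show ?thesis unfolding N_def by force
    qed
    have "inj_on (cyclic_factor k t) U"
      by (rule inj_onI) (use inN in \<open>auto simp: U_def\<close>)
    moreover have "cyclic_factor k t ` U \<subseteq> cyclic_factor k t ` W" by (auto simp: U_def)
    ultimately have "card U \<le> card (cyclic_factor k t ` W)"
      using W(2) by (meson card_inj_on_le finite_imageI)
    also have "\<dots> \<le> card W" by (rule card_image_le[OF W(2)])
    finally have U: "card U \<le> k" using W by simp
    have fU: "finite U" by (rule finite_subset[of _ "{..<l}"]) (auto simp: U_def)
    have "repeated_factors k t \<subseteq> W \<union> N \<union> U"
      using inN by (fastforce simp: repeated_factors_def U_def len)
    then have "card (repeated_factors k t) \<le> card (W \<union> N \<union> U)"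
      using W(2) fU fQ by (intro card_mono) (auto simp: N_def)
    also have "\<dots> \<le> card W + card N + card U"
      by (meson add_right_mono card_Un_le order_trans)
    also have "card N \<le> card (Q t)" unfolding N_def by (rule card_image_le[OF fQ])
    finally show ?thesis using W(1) U by simp
  qed
  have "(\<Sum>t\<in>words A l. card (repeated_factors k t)) \<le> (\<Sum>t\<in>words A l. card (Q t) + 2 * k)"
    by (intro sum_mono each)
  also have "\<dots> = (\<Sum>t\<in>words A l. card (Q t)) + 2 * k * card A ^ l"
    by (simp add: sum.distrib card_words assms(1))
  \<comment> \<open>Double counting: words are counted for each pair of positions instead of pairs
    for each word.\<close>
  also have "(\<Sum>t\<in>words A l. card (Q t))
      = (\<Sum>t\<in>words A l. \<Sum>(u, v)\<in>P. if take k (drop u t) = take k (drop v t) then 1 else 0)"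
    using fP by (intro sum.cong refl)
      (simp add: Q_def case_prod_unfold sum.If_cases Int_def)
  also have "\<dots> = (\<Sum>(u, v)\<in>P. card {t \<in> words A l. take k (drop u t) = take k (drop v t)})"
    by (subst sum.swap)
      (simp add: case_prod_unfold sum.If_cases finite_words[OF assms(1)] Int_def)
  also have "\<dots> \<le> (\<Sum>(u, v)\<in>P. card A ^ (l - k))"
    by (intro sum_mono) (auto simp: P_def intro!: card_equal_factors_le assms)
  also have "\<dots> \<le> l * l * card A ^ (l - k)" using cP by (simp add: case_prod_unfold)
  finally show ?thesis by simp
qed

section \<open>The lower bound\<close>

lemma lossless_compressorD:
  assumes "lossless_compressor \<sigma> n m p M"
  shows "uses_memory \<sigma> m M"
    and "s \<in> words {..<\<sigma>} n \<Longrightarrow> \<exists>out. encoding \<sigma> M p s = Some out"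
    and "inj_on (encoding \<sigma> M p) (words {..<\<sigma>} n)"
proof -
  show "uses_memory \<sigma> m M" using assms by (simp add: lossless_compressor_def)
  show "s \<in> words {..<\<sigma>} n \<Longrightarrow> \<exists>out. encoding \<sigma> M p s = Some out"
    using assms by (simp add: lossless_compressor_def)
  obtain decode where "\<forall>s\<in>words {..<\<sigma>} n. decode (the (encoding \<sigma> M p s)) = s"
    using assms unfolding lossless_compressor_def by blast
  then show "inj_on (encoding \<sigma> M p) (words {..<\<sigma>} n)" by (metis inj_onI)
qed

lemma replicate_in_words: "a \<in> A \<Longrightarrow> replicate n a \<in> words A n"
  by (auto simp: words_def)

lemma lossless_compressor_passes:
  assumes "lossless_compressor \<sigma> n m p M" "\<sigma> \<ge> 1"
  shows "p \<ge> 1"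
  using lossless_compressorD(2)[OF assms(1) replicate_in_words[of 0]] assms(2)
  by (cases p) (auto simp: encoding_def)

section \<open>Crossings of one copy of the period\<close>

definition period_crossings ::
  "nat \<Rightarrow> rw_machine \<Rightarrow> nat \<Rightarrow> nat \<Rightarrow> nat \<Rightarrow> nat \<Rightarrow> nat list \<Rightarrow> crossing list" where
  "period_crossings \<sigma> M p n l j t =
     (let x = initial_stream \<sigma> M (periodic_word n t); i = pad_left M + j * l
      in crossings M p (init_mem M) (take i x) (take l (drop i x)) (drop (i + l) x))"

lemma period_crossings_split:
  assumes "t \<in> words A l" "Suc j * l \<le> n"
  shows "period_crossings \<sigma> M p n l j t =
    crossings M p (init_mem M)
      (replicate (pad_left M) \<sigma> @ take (j * l) (periodic_word n t)) t
      (drop (Suc j * l) (periodic_word n t) @ replicate (pad_right M) \<sigma>)"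
proof -
  have "take l (drop (j * l) (periodic_word n t)) = t"
    using assms by (intro period_of_periodic_word) (auto simp: words_def)
  then show ?thesis
    using assms by (simp add: period_crossings_def initial_stream_def Let_def add.commute)
qed

text \<open>If \<open>t\<close> and \<open>t'\<close> had equal crossings, replacing just the
  \<open>j\<close>-th copy of \<open>t\<close> by \<open>t'\<close> would preserve the encoding,
  against losslessness. The other copies also differ between the two runs, which
  \<open>run_exchange_window\<close> permits.\<close>

lemma inj_on_period_crossings:
  assumes "lossless_compressor \<sigma> n m p M" "Suc j * l \<le> n" "l > 0"
  shows "inj_on (period_crossings \<sigma> M p n l j) (words {..<\<sigma>} l)"
proof (rule inj_onI)
  fix t t' assume t: "t \<in> words {..<\<sigma>} l" and t': "t' \<in> words {..<\<sigma>} l"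
    and eq: "period_crossings \<sigma> M p n l j t = period_crossings \<sigma> M p n l j t'"
  let ?s = "periodic_word n t"
  \<comment> \<open>The mixed word need not be periodic; it only has to be an input of length
    \<open>n\<close>.\<close>
  let ?s' = "take (j * l) ?s @ t' @ drop (Suc j * l) ?s"
  have s: "?s \<in> words {..<\<sigma>} n" by (rule periodic_word_in_words[OF t assms(3)])
  have s': "?s' \<in> words {..<\<sigma>} n"
    using s t' assms(2) by (auto simp: words_def dest: in_set_takeD in_set_dropD)
  have per: "take l (drop (j * l) ?s) = t"
    using t assms(2) by (intro period_of_periodic_word) (auto simp: words_def)
  have "?s = take (j * l) ?s @ take l (drop (j * l) ?s) @ drop (Suc j * l) ?s"
    by (metis append_take_drop_id drop_drop mult_Suc)
  then have split: "?s = take (j * l) ?s @ t @ drop (Suc j * l) ?s"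
    unfolding per .
  have "encoding \<sigma> M p ?s' = encoding \<sigma> M p (take (j * l) ?s @ t @ drop (Suc j * l) ?s)"
    using run_exchange_window[OF eq[unfolded period_crossings_split[OF t assms(2)]
          period_crossings_split[OF t' assms(2)]]]
    by (simp add: encoding_def initial_stream_def)
  then have "encoding \<sigma> M p ?s' = encoding \<sigma> M p ?s"
    unfolding split[symmetric] .
  then have "?s' = ?s"
    using lossless_compressorD(3)[OF assms(1)] s s' by (meson inj_onD)
  then have "take (j * l) ?s @ t' @ drop (Suc j * l) ?s
      = take (j * l) ?s @ t @ drop (Suc j * l) ?s"
    using split by metis
  then show "t = t'" by simp
qed

lemma period_crossings_bounded:
  assumes "uses_memory \<sigma> m M" "t \<in> words {..<\<sigma>} l" "l > 0"
  shows "period_crossings \<sigma> M p n l j t \<in> bounded_crossings m p"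
proof -
  let ?x = "initial_stream \<sigma> M (periodic_word n t)"
  have M: "\<sigma> < cell_syms M" "length (init_mem M) = m"
    using assms(1) by (auto simp: uses_memory_def)
  have "set ?x \<subseteq> {..<cell_syms M}"
    using periodic_word_in_words[OF assms(2,3), of n] M(1)
    by (auto simp: initial_stream_def words_def)
  then show ?thesis
    unfolding period_crossings_def Let_def
    by (intro crossings_bounded[OF assms(1) M(2)])
      (auto dest!: in_set_takeD in_set_dropD)
qed

lemma sum_period_traffic_le:
  assumes "lossless_compressor \<sigma> n m p M" "t \<in> words {..<\<sigma>} l" "l > 0"
  shows "(\<Sum>j<N. traffic (period_crossings \<sigma> M p n l j t))
     \<le> encoded_bits \<sigma> M p (periodic_word n t)"
proof -
  let ?x = "initial_stream \<sigma> M (periodic_word n t)"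
  obtain out where out: "encoding \<sigma> M p (periodic_word n t) = Some out"
    using lossless_compressorD(2)[OF assms(1) periodic_word_in_words[OF assms(2,3)]] by blast
  have "(\<Sum>j<N. traffic (period_crossings \<sigma> M p n l j t))
      \<le> traffic (crossings M p (init_mem M) [] ?x [])"
    using sum_traffic_le[of "\<lambda>j. pad_left M + j * l" M p "init_mem M" ?x N]
    by (simp add: period_crossings_def Let_def mono_def algebra_simps)
  also have "\<dots> = encoded_bits \<sigma> M p (periodic_word n t)"
    using out length_run[of M p "init_mem M" ?x out] by (simp add: encoded_bits_def encoding_def)
  finally show ?thesis .
qed

section \<open>Averages of output and entropy over all periods\<close>

lemma exists_sum_le_average:
  fixes h :: "nat \<Rightarrow> nat"
  assumes "N > 0"
  shows "\<exists>j<N. N * h j \<le> (\<Sum>j<N. h j)"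
proof (rule ccontr)
  assume "\<not> ?thesis"
  then have "(\<Sum>j<N. h j) < N * h j" if "j < N" for j using that by auto
  then have "(\<Sum>j<N. \<Sum>j<N. h j) < (\<Sum>j<N. N * h j)"
    using assms by (intro sum_strict_mono) auto
  then show False by (simp add: sum_distrib_left)
qed

text \<open>Markov's inequality. Rounding the threshold \<open>L\<close> down is harmless, as
  natural numbers above \<open>L\<close> are at least \<open>L + 1\<close>.\<close>

lemma half_below_twice_average:
  fixes h :: "'a \<Rightarrow> nat"
  assumes "finite T"
  shows "card T \<le> 2 * card {t\<in>T. h t \<le> 2 * sum h T div card T}"
proof (rule ccontr)
  define L where "L = 2 * sum h T div card T"
  define B where "B = {t\<in>T. \<not> h t \<le> L}"
  assume "\<not> ?thesis"
  then have less: "2 * card {t\<in>T. h t \<le> L} < card T" by (simp add: L_def)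
  have "card T = card {t\<in>T. h t \<le> L} + card B"
    unfolding B_def using assms by (subst card_Un_disjoint[symmetric])
      (auto intro: arg_cong[where f = card])
  then have B: "card T \<le> 2 * card B" using less by linarith
  have "2 * sum h T < card T * (L + 1)"
    using dividend_less_div_times[of "card T" "2 * sum h T"] less
    unfolding L_def by (simp add: mult.commute)
  also have "\<dots> \<le> 2 * (card B * (L + 1))"
    using mult_right_mono[OF B, of "L + 1"] by (simp add: mult.assoc)
  also have "card B * (L + 1) \<le> (\<Sum>t\<in>B. h t)"
    using sum_bounded_below[of B "L + 1" h] by (force simp: B_def)
  also have "(\<Sum>t\<in>B. h t) \<le> sum h T"
    using assms by (intro sum_mono2) (auto simp: B_def)
  finally show False by simp
qed

text \<open>In a copy with at most average output, half of all \<open>t\<close> produce at most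
  twice the mean over \<open>t\<close>, yet their crossings are distinct; counting bounds that mean
  from below. The factor 4 combines this doubling with that of the prefix code.\<close>

lemma total_encoded_bits_ge:
  assumes "lossless_compressor \<sigma> n m p M" "\<sigma> \<ge> 1" "0 < l" "l \<le> n"
  shows "real \<sigma> ^ l * real (n div l) * (real l * log 2 (real \<sigma>) - real (p * (2 * m + 2) + 2))
     \<le> 4 * real (\<Sum>t\<in>words {..<\<sigma>} l. encoded_bits \<sigma> M p (periodic_word n t))"
proof -
  define T where "T = words {..<\<sigma>} l"
  define N where "N = n div l"
  define S where "S = (\<Sum>t\<in>T. encoded_bits \<sigma> M p (periodic_word n t))"
  have T: "finite T" "card T = \<sigma> ^ l" by (simp_all add: T_def finite_words card_words)
  have N: "N > 0" using assms by (simp add: N_def div_greater_zero_iff)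
  let ?h = "\<lambda>j t. traffic (period_crossings \<sigma> M p n l j t)"
  \<comment> \<open>One copy \<open>j\<close> serves all \<open>t\<close>, since injectivity holds
    for a fixed copy.\<close>
  obtain j where j: "j < N" "N * (\<Sum>t\<in>T. ?h j t) \<le> (\<Sum>j<N. \<Sum>t\<in>T. ?h j t)"
    using exists_sum_le_average[OF N, of "\<lambda>j. \<Sum>t\<in>T. ?h j t"] by (elim exE conjE)
  define a where "a = (\<Sum>t\<in>T. ?h j t)"
  have "(\<Sum>j<N. \<Sum>t\<in>T. ?h j t) = (\<Sum>t\<in>T. \<Sum>j<N. ?h j t)" by (rule sum.swap)
  also have "\<dots> \<le> S"
    unfolding S_def T_def by (intro sum_mono sum_period_traffic_le[OF assms(1) _ assms(3)])
  finally have aS: "N * a \<le> S" using j by (simp add: a_def)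
  define L where "L = 2 * a div card T"
  define H where "H = {t\<in>T. ?h j t \<le> L}"
  have TH: "card T \<le> 2 * card H"
    using half_below_twice_average[OF T(1), of "?h j"] by (simp add: H_def L_def a_def)
  have "Suc j * l \<le> N * l" using j(1) by (intro mult_right_mono) auto
  then have jl: "Suc j * l \<le> n" by (simp add: N_def) (meson div_times_less_eq_dividend le_trans)
  have "card H \<le> 2 ^ (p * (2 * m + 2) + 2 * L + 1)"
  proof (rule card_crossings_le[where F = "period_crossings \<sigma> M p n l j"])
    show "inj_on (period_crossings \<sigma> M p n l j) H"
      using inj_on_period_crossings[OF assms(1) jl assms(3)]
      by (rule inj_on_subset) (auto simp: H_def T_def)
    show "period_crossings \<sigma> M p n l j ` H \<subseteq> bounded_crossings m p"
      using period_crossings_bounded[OF lossless_compressorD(1)[OF assms(1)] _ assms(3)]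
      by (auto simp: H_def T_def)
  qed (simp add: H_def)
  \<comment> \<open>Passing from \<open>H\<close> to all of \<open>T\<close> costs the second extra
    bit in the exponent.\<close>
  then have "\<sigma> ^ l \<le> 2 ^ (p * (2 * m + 2) + 2 * L + 2)"
    using TH T(2) by simp
  then have "real \<sigma> ^ l \<le> 2 ^ (p * (2 * m + 2) + 2 * L + 2)"
    by (metis of_nat_le_iff of_nat_numeral of_nat_power)
  then have "log 2 (real \<sigma> ^ l) \<le> log 2 (2 ^ (p * (2 * m + 2) + 2 * L + 2))"
    using assms(2) by (intro log_mono) auto
  also have "\<dots> = real (p * (2 * m + 2) + 2 * L + 2)"
    by (subst log_nat_power) simp_all
  finally have "real l * log 2 (real \<sigma>) \<le> real (p * (2 * m + 2) + 2 * L + 2)"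
    using assms(2) by (simp only: log_nat_power)
  then have log: "real l * log 2 (real \<sigma>) \<le> real (p * (2 * m + 2) + 2) + 2 * real L"
    by (simp add: algebra_simps)
  have "L * card T \<le> 2 * a" unfolding L_def by simp
  then have L: "real L * real \<sigma> ^ l \<le> 2 * real a"
    unfolding T(2) by (simp flip: of_nat_power of_nat_mult)
  have "real \<sigma> ^ l * real N * (real l * log 2 (real \<sigma>) - real (p * (2 * m + 2) + 2))
      \<le> real \<sigma> ^ l * real N * (2 * real L)"
    using log by (intro mult_left_mono) auto
  also have "\<dots> = 2 * real N * (real L * real \<sigma> ^ l)" by simp
  also have "\<dots> \<le> 2 * real N * (2 * real a)" using L by (intro mult_left_mono) auto
  also have "\<dots> = 4 * real (N * a)" by simp
  also have "\<dots> \<le> 4 * real S" using aS by (simp del: of_nat_mult)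
  finally show ?thesis by (simp add: S_def T_def N_def)
qed

text \<open>On average over \<open>t\<close>, at most \<open>l * l / \<sigma> ^ k + 2 * k\<close>
  cyclic factors are repeated, and each costs at most \<open>log 2 \<sigma>\<close> bits per
  period.\<close>

lemma total_entropy_le:
  assumes "\<sigma> \<ge> 1" "0 < l" "l \<le> n" "1 \<le> k" "k \<le> l"
  shows "(\<Sum>t\<in>words {..<\<sigma>} l. real n * entropy {..<\<sigma>} k (periodic_word n t))
     \<le> real \<sigma> ^ l * (2 * real n * log 2 (real \<sigma>) *
          (real l / real \<sigma> ^ k + 2 * real k / real l))"
proof -
  let ?T = "words {..<\<sigma>} l" and ?lg = "log 2 (real \<sigma>)"
  let ?R = "\<Sum>t\<in>?T. card (repeated_factors k t)"
  have lg: "?lg \<ge> 0" using assms(1) by simp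
  \<comment> \<open>The incomplete last period is absorbed by the factor 2, as
    \<open>l \<le> n\<close>.\<close>
  have N: "real (n div l + 1) \<le> 2 * real n / real l"
  proof -
    have "real (n div l) \<le> real n / real l" by (rule of_nat_div_le_of_nat)
    moreover have "1 \<le> real n / real l" using assms by simp
    ultimately show ?thesis by simp
  qed
  have "(\<Sum>t\<in>?T. real n * entropy {..<\<sigma>} k (periodic_word n t))
      \<le> (\<Sum>t\<in>?T. ?lg * (real (n div l + 1) * real (card (repeated_factors k t))))"
    using length_entropy_periodic_word_le[of "{..<\<sigma>}" _ l k n] assms by (intro sum_mono) auto
  also have "\<dots> = ?lg * (real (n div l + 1) * real ?R)"
    by (simp add: sum_distrib_left)
  also have "\<dots> \<le> ?lg * (2 * real n / real l *
      (real \<sigma> ^ l * (real l * real l / real \<sigma> ^ k + 2 * real k)))"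
  proof (intro mult_left_mono mult_mono N lg)
    have "?R \<le> l * l * \<sigma> ^ (l - k) + 2 * k * \<sigma> ^ l"
      using sum_card_repeated_factors_le[of "{..<\<sigma>}" k l] assms by simp
    then have "real ?R \<le> real (l * l * \<sigma> ^ (l - k) + 2 * k * \<sigma> ^ l)"
      by (rule of_nat_mono)
    also have "\<dots> = real \<sigma> ^ l * (real l * real l / real \<sigma> ^ k + 2 * real k)"
      using assms by (simp add: power_diff[of "real \<sigma>"] field_simps del: of_nat_power)
        (simp add: power_diff[of "real \<sigma>"])
    finally show "real ?R \<le> real \<sigma> ^ l * (real l * real l / real \<sigma> ^ k + 2 * real k)" .
  qed (simp_all add: sum_nonneg)
  also have "\<dots> = real \<sigma> ^ l * (2 * real n * ?lg *
      (real l / real \<sigma> ^ k + 2 * real k / real l))"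
    using assms by (simp add: field_simps)
  finally show ?thesis .
qed

text \<open>The total output is compared with the total entropy bound. The condition on
  \<open>m * p\<close> keeps the memory share to at most half of the
  \<open>l * log 2 \<sigma>\<close> bits of a period; the other two make each entropy term at most
  \<open>1 / 128\<close>.\<close>

lemma redundancy_ge:
  fixes R :: real
  assumes "lossless_compressor \<sigma> n m p M" "\<sigma> \<ge> 2" "m \<ge> 1" "l \<le> n" "1 \<le> k"
    and l: "12 * (m * p) \<le> l" "256 * k \<le> l" "128 * l \<le> \<sigma> ^ k"
    and R: "\<And>s. s \<in> words {..<\<sigma>} n \<Longrightarrow>
      real (encoded_bits \<sigma> M p s) \<le> real n * entropy {..<\<sigma>} k s + R"
  shows "real n \<le> 32 * R"
proof -
  let ?T = "words {..<\<sigma>} l"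
  define g where "g = log 2 (real \<sigma>)"
  define q where "q = real \<sigma> ^ l"
  define N where "N = n div l"
  have g: "g \<ge> 1" using assms(2) by (simp add: g_def)
  have q: "q > 0" using assms(2) by (simp add: q_def)
  have l0: "0 < l" "k \<le> l" using l assms(5) by linarith+
  have p: "p \<ge> 1" using lossless_compressor_passes assms(1,2) by force
  define w where "w = p * (2 * m + 2) + 2"
  have "w \<le> 6 * (m * p)"
  proof -
    have "p \<le> m * p" "1 \<le> m * p" using p assms(3) by (simp_all add: Suc_le_eq)
    moreover have "w = 2 * (m * p) + 2 * p + 2" by (simp add: w_def algebra_simps)
    ultimately show ?thesis by linarith
  qed
  then have "2 * w \<le> l" using l(1) by linarith
  then have "2 * real w \<le> real l" by linarith
  also have "real l \<le> real l * g" using g mult_left_mono[of 1 g "real l"] by simp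
  finally have half: "real l * g / 2 \<le> real l * g - real w" by (simp add: mult.commute)
  \<comment> \<open>At least one full period fits, so dropping the incomplete one loses at most
    half.\<close>
  have "n \<le> 2 * (N * l)"
  proof -
    have "n < (N + 1) * l" using l0 by (simp add: N_def dividend_less_div_times)
    moreover have "N \<ge> 1" using assms(4) l0 by (simp add: N_def Suc_le_eq div_greater_zero_iff)
    then have "l \<le> N * l" by simp
    ultimately show ?thesis by (simp only: distrib_right mult_1 mult_2)
  qed
  then have N: "real n \<le> 2 * (real N * real l)" by (metis of_nat_le_iff of_nat_mult of_nat_numeral)
  have kl: "real l / real \<sigma> ^ k + 2 * real k / real l \<le> 1 / 64"
  proof -
    have "128 * real l \<le> real \<sigma> ^ k" using l(3) by (simp flip: of_nat_power)
    then have "real l / real \<sigma> ^ k \<le> 1 / 128" using assms(2) by (simp add: field_simps)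
    moreover have "256 * real k \<le> real l" using l(2) by simp
    then have "2 * real k / real l \<le> 1 / 128" using l0 by (simp add: field_simps)
    ultimately have "real l / real \<sigma> ^ k + 2 * real k / real l \<le> 1 / 128 + 1 / 128"
      by (rule add_mono)
    also have "\<dots> = (1 / 64 :: real)" by simp
    finally show ?thesis .
  qed
  have "q * (real n * g / 4) \<le> q * (real N * real l * g / 2)"
    using N g q by (intro mult_left_mono) (simp_all add: mult_right_mono)
  also have "\<dots> = q * real N * (real l * g / 2)" by simp
  also have "\<dots> \<le> q * real N * (real l * g - real w)"
    using half q by (intro mult_left_mono) simp_all
  also have "\<dots> \<le> 4 * real (\<Sum>t\<in>?T. encoded_bits \<sigma> M p (periodic_word n t))"
    using total_encoded_bits_ge[OF assms(1) _ l0(1) assms(4)] assms(2)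
    by (simp add: q_def N_def g_def w_def)
  also have "real (\<Sum>t\<in>?T. encoded_bits \<sigma> M p (periodic_word n t))
      \<le> (\<Sum>t\<in>?T. real n * entropy {..<\<sigma>} k (periodic_word n t) + R)"
    unfolding of_nat_sum using l0 by (intro sum_mono R periodic_word_in_words)
  also have "\<dots> = (\<Sum>t\<in>?T. real n * entropy {..<\<sigma>} k (periodic_word n t)) + q * R"
    by (simp add: sum.distrib card_words q_def)
  also have "(\<Sum>t\<in>?T. real n * entropy {..<\<sigma>} k (periodic_word n t))
      \<le> q * (2 * real n * g * (real l / real \<sigma> ^ k + 2 * real k / real l))"
    using total_entropy_le[of \<sigma> l n k] assms(2,4,5) l0 by (simp add: q_def g_def)
  also have "\<dots> \<le> q * (2 * real n * g * (1 / 64))"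
    using kl q g by (intro mult_left_mono) auto
  finally have "q * (real n * g / 4) \<le> q * (4 * (2 * real n * g * (1 / 64) + R))"
    by (simp add: algebra_simps)
  \<comment> \<open>This reads \<open>n * g / 4 \<le> n * g / 8 + 4 * R\<close>, whence the constant
    32.\<close>
  then have "real n * g / 4 \<le> 4 * (2 * real n * g * (1 / 64) + R)"
    using q by (simp only: mult_le_cancel_left_pos)
  then have "real n * g \<le> 32 * R" by (simp add: mult.commute)
  moreover have "real n * 1 \<le> real n * g" using g by (intro mult_left_mono) auto
  ultimately show ?thesis by simp
qed

text \<open>\<open>\<sigma> ^ k\<close> is the least power reaching \<open>2 ^ 30 * d\<close>, so it
  overshoots by a factor of at most \<open>\<sigma>\<close>; then \<open>l\<close> is
  \<open>\<sigma> ^ k div 128\<close>.\<close>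

lemma exists_period_parameters:
  fixes \<sigma> d :: nat
  assumes "\<sigma> \<ge> 2" "d \<ge> 1"
  obtains k l where "k \<ge> 1" "12 * d \<le> l" "256 * k \<le> l" "128 * l \<le> \<sigma> ^ k"
    "\<sigma> ^ k \<le> \<sigma> * 2 ^ 30 * d"
proof -
  have two: "2 ^ k \<le> \<sigma> ^ k" for k using assms(1) by (simp add: power_mono)
  define k where "k = (LEAST k. 2 ^ 30 * d \<le> \<sigma> ^ k)"
  have "2 ^ 30 * d \<le> \<sigma> ^ (2 ^ 30 * d)"
    using less_exp[of "2 ^ 30 * d"] two by (meson le_trans less_imp_le)
  then have k: "2 ^ 30 * d \<le> \<sigma> ^ k" unfolding k_def by (rule LeastI)
  have k1: "k \<ge> 1"
  proof (rule ccontr)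
    assume "\<not> k \<ge> 1"
    then have "k = 0" by simp
    then have "2 ^ 30 * d \<le> 1" using k by simp
    then show False using assms(2) by simp
  qed
  then have "\<not> 2 ^ 30 * d \<le> \<sigma> ^ (k - 1)"
    using not_less_Least[of "k - 1" "\<lambda>k. 2 ^ 30 * d \<le> \<sigma> ^ k"] by (simp add: k_def)
  then have "\<sigma> * \<sigma> ^ (k - 1) \<le> \<sigma> * (2 ^ 30 * d)" by (intro mult_left_mono) auto
  then have upper: "\<sigma> ^ k \<le> \<sigma> * 2 ^ 30 * d"
    using k1 by (simp add: power_eq_if mult.assoc)
  \<comment> \<open>Here \<open>2 ^ 15 = 256 * 128\<close>. Up to \<open>k = 20\<close> the size of
    \<open>2 ^ 30 * d\<close> suffices; beyond that \<open>2 ^ k\<close> grows fast enough.\<close>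
  have ksmall: "2 ^ 15 * k \<le> \<sigma> ^ k"
  proof (cases "k \<le> 20")
    case True
    then show ?thesis using k assms(2) by simp
  next
    case False
    then have "20 \<le> k" by simp
    then have "2 ^ 15 * k \<le> 2 ^ k" by (induction k rule: dec_induct) simp_all
    then show ?thesis using two[of k] by simp
  qed
  show thesis
    by (rule that[of k "\<sigma> ^ k div 128"]) (use k1 k ksmall upper in simp_all)
qed

text \<open>Constant words have zero entropy, so with \<open>R < 1\<close> two of them would share
  the empty encoding.\<close>

lemma redundancy_ge_1:
  fixes R :: real
  assumes "lossless_compressor \<sigma> n m p M" "\<sigma> \<ge> 2" "n \<ge> 1"
    and R: "\<And>s. s \<in> words {..<\<sigma>} n \<Longrightarrow>
      real (encoded_bits \<sigma> M p s) \<le> real n * entropy {..<\<sigma>} 0 s + R"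
  shows "R \<ge> 1"
proof (rule ccontr)
  assume neg: "\<not> R \<ge> 1"
  have empty: "encoding \<sigma> M p (replicate n a) = Some []" if "a < \<sigma>" for a
  proof -
    have w: "replicate n a \<in> words {..<\<sigma>} n" using that by (intro replicate_in_words) simp
    have "entropy {..<\<sigma>} 0 (replicate n a) = 0"
      by (simp add: entropy_def) (rule entropy0_constant[of _ a], auto)
    then have "encoded_bits \<sigma> M p (replicate n a) = 0"
      using R[OF w] neg by simp
    then show ?thesis
      using lossless_compressorD(2)[OF assms(1) w] by (auto simp: encoded_bits_def)
  qed
  have "encoding \<sigma> M p (replicate n 0) = encoding \<sigma> M p (replicate n 1)"
    using empty[of 0] empty[of 1] assms(2) by simp
  then have "replicate n 0 = replicate n (1 :: nat)"
    using assms(2) by (intro inj_onD[OF lossless_compressorD(3)[OF assms(1)]])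
      (auto intro: replicate_in_words)
  then show False using assms(3) by (cases n) auto
qed

text \<open>The order \<open>k\<close> is tuned to \<open>m * p\<close>, so that
  \<open>\<sigma> ^ k\<close> is at most a constant multiple of it; this is why the bound is assumed
  for every \<open>k\<close>.\<close>

lemma memory_passes_redundancy_ge:
  fixes c r :: real
  assumes "lossless_compressor \<sigma> n m p M" "\<sigma> \<ge> 2" "m \<ge> 1" "n \<ge> 1"
    and R: "\<And>k s. s \<in> words {..<\<sigma>} n \<Longrightarrow>
      real (encoded_bits \<sigma> M p s) \<le> real n * entropy {..<\<sigma>} k s + c * (real \<sigma> ^ k * r)"
  shows "real n \<le> 32 * c * real \<sigma> * 2 ^ 30 * (real m * real p * r)"
proof -
  have cr: "c * r \<ge> 1" using redundancy_ge_1[OF assms(1,2,4), of "c * r"] R[of _ 0] by simp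
  have "p \<ge> 1" using lossless_compressor_passes assms(1,2) by force
  then have "m * p \<ge> 1" using assms(3) by (simp add: Suc_le_eq)
  then obtain k l where kl: "k \<ge> 1" "12 * (m * p) \<le> l" "256 * k \<le> l" "128 * l \<le> \<sigma> ^ k"
    "\<sigma> ^ k \<le> \<sigma> * 2 ^ 30 * (m * p)"
    using exists_period_parameters[OF assms(2)] by metis
  have "real (\<sigma> ^ k) \<le> real (\<sigma> * 2 ^ 30 * (m * p))" using kl(5) by (rule of_nat_mono)
  then have "real \<sigma> ^ k \<le> real \<sigma> * 2 ^ 30 * (real m * real p)" by simp
  then have "32 * (c * r) * real \<sigma> ^ k \<le> 32 * (c * r) * (real \<sigma> * 2 ^ 30 * (real m * real p))"
    using cr by (intro mult_left_mono) auto
  moreover have "real n \<le> 32 * (c * r) * real \<sigma> ^ k"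
  proof (cases "l \<le> n")
    case True
    then show ?thesis
      using redundancy_ge[OF assms(1,2,3) True kl(1-4), of "c * (real \<sigma> ^ k * r)"] R
      by (simp add: mult_ac)
  next
    case False
    \<comment> \<open>For inputs shorter than a period, \<open>c * r \<ge> 1\<close> alone
      suffices.\<close>
    then have "n \<le> \<sigma> ^ k" using kl(4) by linarith
    then have "real n \<le> 1 * real \<sigma> ^ k" by (simp flip: of_nat_power)
    also have "\<dots> \<le> 32 * (c * r) * real \<sigma> ^ k" using cr by (intro mult_right_mono) auto
    finally show ?thesis .
  qed
  ultimately show ?thesis by (simp add: mult_ac)
qed

theorem theorem15:
  fixes \<sigma> :: nat
    and m p :: "nat \<Rightarrow> nat"
    and r f :: "nat \<Rightarrow> real"
    and M :: "nat \<Rightarrow> rw_machine"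
  assumes "\<sigma> \<ge> 2"
    and "\<forall>\<^sub>F n in sequentially. m n \<ge> 1"
    and "\<forall>\<^sub>F n in sequentially. r n \<ge> 0"
    and "\<forall>\<^sub>F n in sequentially. lossless_compressor \<sigma> n (m n) (p n) (M n)"
    and "universal_compression \<sigma> p r M"
    and "filterlim f at_top sequentially"
  shows "(\<lambda>n. real (m n) * real (p n) * r n) \<in> \<Omega>(\<lambda>n. real n / f n)"
proof -
  obtain c where c: "\<forall>\<^sub>F n in sequentially. \<forall>k. \<forall>s\<in>words {..<\<sigma>} n.
        real (encoded_bits \<sigma> (M n) (p n) s)
          \<le> real n * entropy {..<\<sigma>} k s + c * (real \<sigma> ^ k * r n)"
    using assms(5) unfolding universal_compression_def by blast
  \<comment> \<open>The hidden constant \<open>c\<close> could be nonpositive; as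
    \<open>r n \<ge> 0\<close>, it may be raised to \<open>max c 1\<close>.\<close>
  define C where "C = 32 * max c 1 * real \<sigma> * 2 ^ 30"
  have C: "C > 0" using assms(1) by (simp add: C_def)
  have "\<forall>\<^sub>F n in sequentially. f n \<ge> 1"
    using assms(6) by (simp add: filterlim_at_top)
  then have "\<forall>\<^sub>F n in sequentially.
      norm (real (m n) * real (p n) * r n) \<ge> 1 / C * norm (real n / f n)"
    using assms(2-4) c eventually_ge_at_top[of 1]
  proof eventually_elim
    case (elim n)
    have "real (encoded_bits \<sigma> (M n) (p n) s)
        \<le> real n * entropy {..<\<sigma>} k s + max c 1 * (real \<sigma> ^ k * r n)"
      if "s \<in> words {..<\<sigma>} n" for k s
    proof -
      have "c * (real \<sigma> ^ k * r n) \<le> max c 1 * (real \<sigma> ^ k * r n)"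
        using elim(3) by (intro mult_right_mono) auto
      moreover have "real (encoded_bits \<sigma> (M n) (p n) s)
          \<le> real n * entropy {..<\<sigma>} k s + c * (real \<sigma> ^ k * r n)"
        using elim(5) that by blast
      ultimately show ?thesis by linarith
    qed
    then have "real n \<le> C * (real (m n) * real (p n) * r n)"
      unfolding C_def using elim assms(1) by (intro memory_passes_redundancy_ge) auto
    then have "1 / C * real n \<le> real (m n) * real (p n) * r n"
      using C by (simp add: field_simps)
    \<comment> \<open>Since \<open>f n \<ge> 1\<close>, division by \<open>f n\<close> does not
      increase the value.\<close>
    moreover have "norm (real n / f n) \<le> real n"
      using elim(1) mult_left_mono[of 1 "f n" "real n"] by (simp add: field_simps)
    then have "1 / C * norm (real n / f n) \<le> 1 / C * real n"
      using C by (intro mult_left_mono) auto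
    ultimately show ?case by simp
  qed
  then show ?thesis using C by (intro landau_omega.bigI[of "1 / C"]) auto
qed

end
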